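(* Let $G=(V,P,d)$ be a reversible metric Markov chain with non-negative Ollivier Ricci curvature. Then \[ \alpha_{\operatorname{spectral}}\ge\frac{P_0}{16\operatorname{diam}(G)^2}. \]
   Context: $V$ finite; $P$ with symmetric support; $x\sim y$ iff $x\ne y$, $P(x,y)>0$; $d$ is a finite path distance ($d(x,y)=\inf\sum d(x_{k-1},x_k)$ over paths $x=x_0\sim\dots\sim x_n=y$); $m$ is the probability with $m(x)P(x,y)=m(y)P(y,x)$. $\Delta f(x)=\sum_yP(x,y)(f(y)-f(x))$, $\langle f,g\rangle=\sum fgm$, $\|f\|_2=\langle f,f\rangle^{1/2}$, $\mathcal E(f,g)=-\langle\Delta f,g\rangle$. $\operatorname{Lip}(1)=\{f:|f(y)-f(x)|\le d(x,y)\}$; Ollivier curvature $\kappa(x,y)=\inf\{(\Delta f(x)-\Delta f(y))/d(x,y): f\in\operatorname{Lip}(1), f(y)-f(x)=d(x,y)\}$, assumed $\ge0$ for all $x\sim y$. $P_0=\inf_{x\sim y}P(x,y)d(x,y)^2$; $\operatorname{diam}(G)=\max_{x,y}d(x,y)$. For nonempty $X\subsetneq V$, $\lambda_X=\inf\{\mathcal E(f,f):\|f\|_2=1, f|_{V\setminus X}=0\}$; $\theta(s,t)=(s-t)/(\log s-\log t)$, $\theta(s,s)=s$; $\alpha_{\operatorname{spectral}}=\inf_X\theta(\lambda_X,\lambda_{V\setminus X})$ over nonempty proper $X\subset V$. *)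

theory Defs
  imports Complex_Main
begin

text \<open>Vertex set V is the finite type 'a. P is a Markov kernel, d a metric, m a measure.\<close>

definition adj :: "('a \<Rightarrow> 'a \<Rightarrow> real) \<Rightarrow> 'a \<Rightarrow> 'a \<Rightarrow> bool" where
  "adj P x y \<longleftrightarrow> x \<noteq> y \<and> P x y > 0"

definition paths :: "('a \<Rightarrow> 'a \<Rightarrow> real) \<Rightarrow> 'a \<Rightarrow> 'a \<Rightarrow> 'a list set" where
  "paths P x y = {xs. xs \<noteq> [] \<and> hd xs = x \<and> last xs = y \<and>
      (\<forall>i. Suc i < length xs \<longrightarrow> adj P (xs ! i) (xs ! Suc i))}"

definition path_length :: "('a \<Rightarrow> 'a \<Rightarrow> real) \<Rightarrow> 'a list \<Rightarrow> real" where
  "path_length d xs = (\<Sum>i<length xs - 1. d (xs ! i) (xs ! Suc i))"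

definition path_distance :: "('a \<Rightarrow> 'a \<Rightarrow> real) \<Rightarrow> ('a \<Rightarrow> 'a \<Rightarrow> real) \<Rightarrow> bool" where
  "path_distance P d \<longleftrightarrow> (\<forall>x y. paths P x y \<noteq> {} \<and>
      d x y = Inf (path_length d ` paths P x y))"

definition metric_fun :: "('a \<Rightarrow> 'a \<Rightarrow> real) \<Rightarrow> bool" where
  "metric_fun d \<longleftrightarrow> (\<forall>x y. d x y \<ge> 0 \<and> (d x y = 0 \<longleftrightarrow> x = y) \<and> d x y = d y x) \<and>
     (\<forall>x y z. d x z \<le> d x y + d y z)"

definition laplacian :: "('a::finite \<Rightarrow> 'a \<Rightarrow> real) \<Rightarrow> ('a \<Rightarrow> real) \<Rightarrow> 'a \<Rightarrow> real" where
  "laplacian P f x = (\<Sum>y\<in>UNIV. P x y * (f y - f x))"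

definition inner_m :: "('a::finite \<Rightarrow> real) \<Rightarrow> ('a \<Rightarrow> real) \<Rightarrow> ('a \<Rightarrow> real) \<Rightarrow> real" where
  "inner_m m f g = (\<Sum>x\<in>UNIV. f x * g x * m x)"

definition norm2_m :: "('a::finite \<Rightarrow> real) \<Rightarrow> ('a \<Rightarrow> real) \<Rightarrow> real" where
  "norm2_m m f = sqrt (inner_m m f f)"

definition energy :: "('a::finite \<Rightarrow> 'a \<Rightarrow> real) \<Rightarrow> ('a \<Rightarrow> real) \<Rightarrow> ('a \<Rightarrow> real) \<Rightarrow> ('a \<Rightarrow> real) \<Rightarrow> real" where
  "energy P m f g = - inner_m m (laplacian P f) g"

definition lip1 :: "('a \<Rightarrow> 'a \<Rightarrow> real) \<Rightarrow> ('a \<Rightarrow> real) \<Rightarrow> bool" where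
  "lip1 d f \<longleftrightarrow> (\<forall>x y. \<bar>f y - f x\<bar> \<le> d x y)"

definition ollivier_curvature ::
  "('a::finite \<Rightarrow> 'a \<Rightarrow> real) \<Rightarrow> ('a \<Rightarrow> 'a \<Rightarrow> real) \<Rightarrow> 'a \<Rightarrow> 'a \<Rightarrow> real" where
  "ollivier_curvature P d x y =
     Inf {(laplacian P f x - laplacian P f y) / d x y | f. lip1 d f \<and> f y - f x = d x y}"

definition P0 :: "('a \<Rightarrow> 'a \<Rightarrow> real) \<Rightarrow> ('a \<Rightarrow> 'a \<Rightarrow> real) \<Rightarrow> real" where
  "P0 P d = Inf {P x y * (d x y)\<^sup>2 | x y. adj P x y}"

definition diam :: "('a::finite \<Rightarrow> 'a \<Rightarrow> real) \<Rightarrow> real" where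
  "diam d = Max {d x y | x y. True}"

definition lambda_set ::
  "('a::finite \<Rightarrow> 'a \<Rightarrow> real) \<Rightarrow> ('a \<Rightarrow> real) \<Rightarrow> 'a set \<Rightarrow> real" where
  "lambda_set P m X = Inf {energy P m f f | f. norm2_m m f = 1 \<and> (\<forall>x. x \<notin> X \<longrightarrow> f x = 0)}"

definition theta :: "real \<Rightarrow> real \<Rightarrow> real" where
  "theta s t = (if s = t then s else (s - t) / (ln s - ln t))"

definition alpha_spectral :: "('a::finite \<Rightarrow> 'a \<Rightarrow> real) \<Rightarrow> ('a \<Rightarrow> real) \<Rightarrow> real" where
  "alpha_spectral P m = Inf {theta (lambda_set P m X) (lambda_set P m (UNIV - X)) | X.
      X \<noteq> {} \<and> X \<noteq> UNIV}"

end

theory Submission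
  imports Defs "HOL-Analysis.Brouwer_Fixpoint" "HOL-Analysis.Cartesian_Euclidean_Space"
begin

text \<open>
  Non-negative curvature makes the lazy step \<open>f + \<Delta>f / 2\<close> preserve 1-Lipschitz functions, and a fixed
  point argument yields a 1-Lipschitz \<open>f\<close> and a constant \<open>c\<close> with \<open>\<Delta>f \<ge> c\<close> on \<open>X\<close>, \<open>\<Delta>f \<le> c\<close> off \<open>X\<close>,
  that grows with maximal slope from each point of \<open>X\<close> and decreases with maximal slope from each
  point of the complement. Composing \<open>f\<close> with concave functions of one variable then gives positive
  supersolutions on both sides. If \<open>D\<close> is the diameter and \<open>q = max 1 (\<bar>c\<bar> D / P\<^sub>0)\<close>, the side on which
  the drift points to the boundary has eigenvalue at least \<open>l = q P\<^sub>0 / D\<^sup>2\<close> (linear or quadratic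
  barrier), the other one at least \<open>l exp (- 4 q)\<close> (exponential barrier). The logarithmic mean of
  these two numbers is \<open>(1 - exp (- 4 q)) P\<^sub>0 / (4 D\<^sup>2)\<close>, which exceeds \<open>P\<^sub>0 / (16 D\<^sup>2)\<close>.
\<close>

section \<open>Lower bounds for the logarithmic mean\<close>

lemma theta_commute: "theta s t = theta t s"
  unfolding theta_def by (metis minus_diff_eq minus_divide_divide)

lemma theta_ge_of_min:
  assumes "0 < c" "c \<le> s" "c \<le> t"
  shows "c \<le> theta s t"
proof -
  have *: "c \<le> theta a b" if "c \<le> b" "b < a" for a b
  proof -
    have pos: "0 < ln a - ln b" using that assms by simp
    have "c * (ln a - ln b) = c * ln (a / b)" using that assms by (simp add: ln_div)
    also have "\<dots> \<le> c * (a / b - 1)"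
      using that assms by (intro mult_left_mono ln_le_minus_one) auto
    also have "\<dots> = c / b * (a - b)" using that assms by (simp add: field_simps)
    also have "\<dots> \<le> 1 * (a - b)" using that assms by (intro mult_right_mono) auto
    finally show ?thesis using pos that by (simp add: theta_def pos_le_divide_eq)
  qed
  show ?thesis
    using *[of t s] *[of s t] assms theta_commute[of s t]
    by (cases s t rule: linorder_cases) (auto simp: theta_def)
qed

text \<open>With \<open>l = 16 * c * q\<close>, the factor \<open>exp (- 4 * q)\<close> lowers the
  logarithm by \<open>4 * q\<close>, which costs only \<open>c * (4 * q) = l / 4\<close> of the
  difference \<open>s - t\<close>. For \<open>t < c \<le> l / 16\<close> this leaves ample
  room.\<close>

lemma theta_ge:
  assumes c: "0 < c" and q: "1 \<le> q" and s: "16 * c * q \<le> s" and t: "16 * c * q * exp (- 4 * q) \<le> t"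
  shows "c \<le> theta s t"
proof (cases "c \<le> t")
  case True
  have "c * 1 \<le> 16 * c * q" using c q by (intro mult_mono) auto
  then have "c \<le> s" using s by linarith
  with True c show ?thesis by (intro theta_ge_of_min)
next
  case False
  define l where "l = 16 * c * q"
  have lc: "16 * c \<le> l" using c q by (simp add: l_def)
  have l: "0 < l" using c lc by linarith
  have s': "l \<le> s" using s by (simp add: l_def)
  have tl: "l * exp (- 4 * q) \<le> t" using t by (simp add: l_def)
  have t0: "0 < t" using tl l by (smt (verit) exp_gt_zero mult_pos_pos)
  have "ln (l * exp (- 4 * q)) \<le> ln t" using tl l t0 by (subst ln_le_cancel_iff) auto
  then have lnt: "ln l - 4 * q \<le> ln t" using l by (simp add: ln_mult)
  \<comment> \<open>Beyond \<open>l\<close> the logarithm has slope at most \<open>1 / l\<close>, so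
    after multiplication by \<open>c\<close> the excess \<open>s - l\<close> costs at most a
    sixteenth of itself.\<close>
  have "ln (s / l) \<le> s / l - 1" using l s' by (intro ln_le_minus_one) auto
  then have lns: "ln s \<le> ln l + (s / l - 1)" using l s' by (simp add: ln_div)
  have "c * (ln s - ln t) \<le> c * ((s / l - 1) + 4 * q)"
    using lns lnt c by (intro mult_left_mono) auto
  also have "\<dots> = c / l * (s - l) + c * (4 * q)" using l by (simp add: field_simps)
  also have "c * (4 * q) = l / 4" by (simp add: l_def)
  also have "c / l * (s - l) + l / 4 \<le> 1 / 16 * (s - l) + l / 4"
    using l lc s' by (intro add_mono mult_right_mono) (auto simp: field_simps)
  also have "\<dots> \<le> s - t" using False lc s' c by argo
  finally have "c * (ln s - ln t) \<le> s - t" .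
  moreover have "t < s" using False lc s' c by linarith
  ultimately show ?thesis using t0 by (simp add: theta_def pos_le_divide_eq)
qed

section \<open>Lipschitz functions and their extremal extensions\<close>

lemma lip1_iff: "metric_fun d \<Longrightarrow> lip1 d f \<longleftrightarrow> (\<forall>x y. f y - f x \<le> d x y)"
  unfolding lip1_def metric_fun_def by (smt (verit))

text \<open>McShane extension: the largest 1-Lipschitz function lying below \<open>g\<close> on
  \<open>X\<close>.\<close>

lemma lip1_Min:
  assumes "metric_fun d" and "finite X" and "X \<noteq> {}"
  shows "lip1 d (\<lambda>z. MIN x\<in>X. g x + d x z)"
  unfolding lip1_iff[OF assms(1)]
proof (intro allI)
  fix y z
  have "(MIN x\<in>X. g x + d x y) \<in> (\<lambda>x. g x + d x y) ` X" using assms by (intro Min_in) auto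
  then obtain x where x: "x \<in> X" "(MIN x\<in>X. g x + d x y) = g x + d x y" by auto
  have "(MIN x\<in>X. g x + d x z) \<le> g x + d x z" using assms x by (intro Min_le) auto
  also have "\<dots> \<le> g x + (d x y + d y z)"
    using assms(1) unfolding metric_fun_def by (intro add_left_mono) blast
  finally show "(MIN x\<in>X. g x + d x z) - (MIN x\<in>X. g x + d x y) \<le> d y z" using x(2) by linarith
qed

text \<open>Dual extension: the smallest 1-Lipschitz function lying above \<open>g\<close> on
  \<open>X\<close>.\<close>

lemma lip1_Max:
  assumes "metric_fun d" and "finite X" and "X \<noteq> {}"
  shows "lip1 d (\<lambda>z. MAX x\<in>X. g x - d z x)"
  unfolding lip1_iff[OF assms(1)]
proof (intro allI)
  fix y z
  have "(MAX x\<in>X. g x - d z x) \<in> (\<lambda>x. g x - d z x) ` X" using assms by (intro Max_in) auto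
  then obtain x where x: "x \<in> X" "(MAX x\<in>X. g x - d z x) = g x - d z x" by auto
  have "g x - (d y z + d z x) \<le> g x - d y x"
    using assms(1) unfolding metric_fun_def by (intro diff_left_mono) blast
  also have "\<dots> \<le> (MAX x\<in>X. g x - d y x)" using assms x by (intro Max_ge) auto
  finally show "(MAX x\<in>X. g x - d z x) - (MAX x\<in>X. g x - d y x) \<le> d y z" using x(2) by linarith
qed

lemma continuous_on_MIN:
  fixes f :: "'i \<Rightarrow> 'b::topological_space \<Rightarrow> real"
  assumes "finite I" "I \<noteq> {}" "\<And>i. i \<in> I \<Longrightarrow> continuous_on S (f i)"
  shows "continuous_on S (\<lambda>v. MIN i\<in>I. f i v)"
  using assms by (induction rule: finite_ne_induct) (auto intro!: continuous_intros)

lemma continuous_on_MAX: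
  fixes f :: "'i \<Rightarrow> 'b::topological_space \<Rightarrow> real"
  assumes "finite I" "I \<noteq> {}" "\<And>i. i \<in> I \<Longrightarrow> continuous_on S (f i)"
  shows "continuous_on S (\<lambda>v. MAX i\<in>I. f i v)"
  using assms by (induction rule: finite_ne_induct) (auto intro!: continuous_intros)

section \<open>Laplacian of shifts and reflections; path distances\<close>

lemma laplacian_add_const: "laplacian P (\<lambda>x. f x + c) = laplacian P f"
  by (simp add: laplacian_def fun_eq_iff)

lemma laplacian_minus: "laplacian P (\<lambda>x. c - f x) x = - laplacian P f x"
  by (simp add: laplacian_def sum_negf[symmetric] algebra_simps)

lemma path_length_ge:
  assumes "xs \<noteq> []" and "\<forall>i. Suc i < length xs \<longrightarrow> adj P (xs ! i) (xs ! Suc i)"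
    and "\<And>x y. adj P x y \<Longrightarrow> g y - g x \<le> d x y"
  shows "g (last xs) - g (hd xs) \<le> path_length d xs"
proof -
  have "g (last xs) - g (hd xs) = (\<Sum>i<length xs - 1. g (xs ! Suc i) - g (xs ! i))"
    using assms(1) sum_lessThan_telescope[of "\<lambda>i. g (xs ! i)" "length xs - 1"]
    by (simp add: last_conv_nth hd_conv_nth)
  also have "\<dots> \<le> path_length d xs"
    unfolding path_length_def using assms(2,3) by (intro sum_mono) auto
  finally show ?thesis .
qed

lemma path_distance_lip:
  assumes d: "path_distance P d" and g: "\<And>x y. adj P x y \<Longrightarrow> g y - g x \<le> d x y"
  shows "g y - g x \<le> d x y"
proof -
  have "g y - g x \<le> Inf (path_length d ` paths P x y)"
  proof (rule cInf_greatest)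
    show "path_length d ` paths P x y \<noteq> {}" using d by (auto simp: path_distance_def)
    fix r assume "r \<in> path_length d ` paths P x y"
    then show "g y - g x \<le> r" using path_length_ge[where g = g and d = d and P = P] g by (auto simp: paths_def)
  qed
  then show ?thesis using d by (simp add: path_distance_def)
qed

text \<open>There may be infinitely many paths, but one with first step \<open>z\<close> has length
  at least \<open>d x z + d z y\<close>, and only finitely many \<open>z\<close> occur; the best one
  gives equality.\<close>

lemma path_distance_first_step:
  fixes P :: "'a::finite \<Rightarrow> 'a \<Rightarrow> real"
  assumes m: "metric_fun d" and d: "path_distance P d" and "x \<noteq> y"
  obtains z where "adj P x z" "d x y = d x z + d z y"
proof -
  define A where "A = (\<lambda>z. d x z + d z y) ` {z. adj P x z}"
  have tri: "d u w \<le> d u v + d v w" for u v w using m unfolding metric_fun_def by blast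
  have len: "\<exists>z. adj P x z \<and> d x z + d z y \<le> path_length d xs" if "xs \<in> paths P x y" for xs
  proof -
    obtain z ys where xs: "xs = x # z # ys"
      using \<open>xs \<in> paths P x y\<close> \<open>x \<noteq> y\<close> unfolding paths_def
      by (cases xs rule: remdups_adj.cases) (auto split: if_splits)
    have st: "adj P (xs ! i) (xs ! Suc i)" if "Suc i < length xs" for i
      using that \<open>xs \<in> paths P x y\<close> by (auto simp: paths_def)
    have z: "adj P x z" using st[of 0] by (simp add: xs)
    have "adj P ((z # ys) ! i) ((z # ys) ! Suc i)" if "Suc i < length (z # ys)" for i
      using st[of "Suc i"] that by (simp add: xs)
    \<comment> \<open>By the triangle inequality \<open>- d v y\<close> grows by at most
      \<open>d\<close> on each edge, so the remaining path is at least as long as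
      \<open>d z y\<close>.\<close>
    then have "- d (last (z # ys)) y - (- d (hd (z # ys)) y) \<le> path_length d (z # ys)"
      using tri by (intro path_length_ge[where P = P and g = "\<lambda>v. - d v y"]) (auto simp: algebra_simps)
    moreover have "last (z # ys) = y" using that by (auto simp: paths_def xs)
    moreover have "d y y = 0" using m by (simp add: metric_fun_def)
    moreover have "path_length d xs = d x z + path_length d (z # ys)"
      by (simp add: path_length_def xs sum.lessThan_Suc_shift del: sum.lessThan_Suc)
    ultimately show ?thesis using z by auto
  qed
  obtain xs where xs: "xs \<in> paths P x y" using d by (auto simp: path_distance_def)
  have A: "finite A" "A \<noteq> {}" using len[OF xs] by (auto simp: A_def)
  have "Min A \<le> Inf (path_length d ` paths P x y)"
  proof (rule cInf_greatest)
    show "path_length d ` paths P x y \<noteq> {}" using xs by auto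
    fix r assume "r \<in> path_length d ` paths P x y"
    then obtain z where "adj P x z" "d x z + d z y \<le> r" using len by auto
    moreover from this have "Min A \<le> d x z + d z y" using A by (intro Min_le) (auto simp: A_def)
    ultimately show "Min A \<le> r" by linarith
  qed
  then have "Min A \<le> d x y" using d by (simp add: path_distance_def)
  moreover obtain z where "adj P x z" "Min A = d x z + d z y"
    using Min_in[OF A] by (auto simp: A_def)
  ultimately show ?thesis using that tri[of x y z] by force
qed

section \<open>Reversible chains: positivity and finiteness\<close>

locale reversible_metric_chain =
  fixes P d :: "'a::finite \<Rightarrow> 'a \<Rightarrow> real" and m :: "'a \<Rightarrow> real"
  assumes nontriv: "\<exists>x y :: 'a. x \<noteq> y"
    and P_nonneg: "P x y \<ge> 0"
    and P_stoch: "(\<Sum>y\<in>UNIV. P x y) = 1"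
    and P_sym_supp: "P x y > 0 \<longleftrightarrow> P y x > 0"
    and d_metric: "metric_fun d"
    and d_path: "path_distance P d"
    and m_nonneg: "m x \<ge> 0"
    and m_prob: "(\<Sum>x\<in>UNIV. m x) = 1"
    and reversible: "m x * P x y = m y * P y x"
begin

lemma d_nonneg: "0 \<le> d x y" and d_sym: "d x y = d y x"
  and d_eq_0_iff: "d x y = 0 \<longleftrightarrow> x = y" and d_triangle: "d x z \<le> d x y + d y z"
  using d_metric unfolding metric_fun_def by blast+

lemma d_refl [simp]: "d x x = 0"
  by (simp add: d_eq_0_iff)

lemma d_pos: "x \<noteq> y \<Longrightarrow> 0 < d x y"
  using d_nonneg[of x y] d_eq_0_iff[of x y] by linarith

lemma lip1_le: "lip1 d f \<Longrightarrow> f y - f x \<le> d x y"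
  using lip1_iff[OF d_metric] by blast

lemma laplacian_eq: "laplacian P f x = (\<Sum>y\<in>UNIV. P x y * f y) - f x"
  by (simp add: laplacian_def right_diff_distrib sum_subtractf sum_distrib_right[symmetric] P_stoch)

lemma m_pos: "0 < m x"
proof (rule ccontr)
  assume "\<not> 0 < m x"
  then have x: "m x = 0" using m_nonneg[of x] by linarith
  have "m y = 0" for y
  proof (rule ccontr)
    assume y: "m y \<noteq> 0"
    \<comment> \<open>Detailed balance spreads zeros of \<open>m\<close> along edges, so a function
      depending only on whether \<open>m\<close> vanishes has no jump on any edge. The height
      \<open>d x y + 1\<close> then violates the Lipschitz bound between \<open>x\<close> and
      \<open>y\<close>.\<close>
    have "m u = 0 \<longleftrightarrow> m v = 0" if "adj P u v" for u v
      using that reversible[of u v] P_sym_supp[of u v] unfolding adj_def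
      by (metis less_irrefl mult_eq_0_iff)
    then have "(if m v = 0 then 0 else d x y + 1) - (if m u = 0 then 0 else d x y + 1) \<le> d u v"
      if "adj P u v" for u v
      using that d_nonneg[of u v] by simp
    from path_distance_lip[OF d_path, where g = "\<lambda>v. if m v = 0 then 0 else d x y + 1", OF this, of y x]
    show False using x y by simp
  qed
  then show False using m_prob by simp
qed

lemma ex_adj: "\<exists>x y. adj P x y"
  using nontriv path_distance_first_step[OF d_metric d_path] by metis

lemma finite_P0_set: "finite {P x y * (d x y)\<^sup>2 |x y. adj P x y}"
  by (rule finite_subset[of _ "(\<lambda>(x, y). P x y * (d x y)\<^sup>2) ` UNIV"]) auto

lemma P0_le: "adj P x y \<Longrightarrow> P0 P d \<le> P x y * (d x y)\<^sup>2"
  unfolding P0_def by (rule cInf_lower) (auto intro: bdd_below_finite finite_P0_set)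

lemma P0_pos: "0 < P0 P d"
proof -
  have ne: "{P x y * (d x y)\<^sup>2 |x y. adj P x y} \<noteq> {}" using ex_adj by auto
  have "P0 P d = Min {P x y * (d x y)\<^sup>2 |x y. adj P x y}"
    unfolding P0_def using ne finite_P0_set by (rule cInf_eq_Min[rotated])
  also have "\<dots> > 0"
    using ne finite_P0_set by (subst Min_gr_iff) (auto simp: adj_def d_eq_0_iff)
  finally show ?thesis .
qed

lemma finite_diam_set: "finite {d x y |x y. True}"
  by (rule finite_subset[of _ "(\<lambda>(x, y). d x y) ` UNIV"]) auto

lemma diam_ge: "d x y \<le> diam d"
  unfolding diam_def using finite_diam_set by (rule Max_ge) auto

lemma diam_pos: "0 < diam d"
  using nontriv d_pos diam_ge less_le_trans by blast

section \<open>Dirichlet eigenvalue bounds from barriers\<close>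

lemma energy_eq: "energy P m g g = inner_m m g g - (\<Sum>x\<in>UNIV. \<Sum>y\<in>UNIV. m x * P x y * (g x * g y))"
  unfolding energy_def inner_m_def laplacian_eq
  by (simp add: sum_subtractf[symmetric] sum_negf[symmetric] algebra_simps sum_distrib_left sum_distrib_right
      sum.distrib)

text \<open>Barta's criterion: a positive supersolution on \<open>X\<close> bounds the Dirichlet eigenvalue from below.\<close>

lemma lambda_set_ge:
  assumes X: "X \<noteq> {}" and u0: "\<And>x. 0 \<le> u x" and u: "\<And>x. x \<in> X \<Longrightarrow> 0 < u x"
    and sup: "\<And>x. x \<in> X \<Longrightarrow> laplacian P u x \<le> - l * u x"
  shows "l \<le> lambda_set P m X"
  unfolding lambda_set_def
proof (rule cInf_greatest)
  obtain x where x: "x \<in> X" using X by auto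
  define f where "f = (\<lambda>z. if z = x then 1 / sqrt (m x) else 0)"
  have "inner_m m f f = (\<Sum>z\<in>UNIV. if z = x then 1 else 0)"
    unfolding inner_m_def f_def using m_pos[of x]
    by (intro sum.cong) auto
  then have "norm2_m m f = 1" by (simp add: norm2_m_def)
  then show "{energy P m f f |f. norm2_m m f = 1 \<and> (\<forall>x. x \<notin> X \<longrightarrow> f x = 0)} \<noteq> {}"
    using x by (auto simp: f_def split: if_splits intro!: exI[of _ f])
next
  fix e assume "e \<in> {energy P m f f |f. norm2_m m f = 1 \<and> (\<forall>x. x \<notin> X \<longrightarrow> f x = 0)}"
  then obtain g where e: "e = energy P m g g" and n: "inner_m m g g = 1" and g: "\<And>x. x \<notin> X \<Longrightarrow> g x = 0"
    by (auto simp: norm2_m_def)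
  define w where "w = (\<lambda>x y. m x * P x y)"
  \<comment> \<open>On \<open>X\<close>, \<open>g x * g y\<close> is up to sign the geometric mean
    of \<open>a x y\<close> and \<open>a y x\<close>. For \<open>x\<close> outside \<open>X\<close>,
    where \<open>u x\<close> may vanish, \<open>g x = 0\<close> makes \<open>a x y\<close>
    zero.\<close>
  define a where "a = (\<lambda>x y. (g x)\<^sup>2 / u x * u y)"
  have w: "w x y = w y x" "0 \<le> w x y" for x y
    using reversible m_nonneg P_nonneg by (auto simp: w_def)
  have ineq: "g x * g y \<le> (a x y + a y x) / 2" for x y
  proof (cases "x \<in> X \<and> y \<in> X")
    case True
    then have pos: "0 < u x" "0 < u y" using u by auto
    have "0 \<le> (g x * u y - g y * u x)\<^sup>2 / (u x * u y)" using pos by simp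
    also have "\<dots> = a x y + a y x - 2 * (g x * g y)"
      using pos by (simp add: a_def field_simps power2_eq_square)
    finally show ?thesis by simp
  next
    case False
    then have "g x * g y = 0" using g by auto
    moreover have "0 \<le> (a x y + a y x) / 2" using u0 by (simp add: a_def)
    ultimately show ?thesis by (simp only:)
  qed
  have "(\<Sum>x\<in>UNIV. \<Sum>y\<in>UNIV. w x y * (g x * g y)) \<le> (\<Sum>x\<in>UNIV. \<Sum>y\<in>UNIV. w x y * ((a x y + a y x) / 2))"
    by (intro sum_mono mult_left_mono ineq w)
  \<comment> \<open>Reversibility is used here: after it the two halves differ only by exchanging
    the summation indices.\<close>
  also have "\<dots> = (\<Sum>x\<in>UNIV. \<Sum>y\<in>UNIV. (w x y * a x y + w y x * a y x) / 2)"
  proof (intro sum.cong refl)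
    fix x y
    show "w x y * ((a x y + a y x) / 2) = (w x y * a x y + w y x * a y x) / 2"
      unfolding w(1)[of y x] by (simp add: distrib_left)
  qed
  also have "\<dots> = ((\<Sum>x\<in>UNIV. \<Sum>y\<in>UNIV. w x y * a x y) + (\<Sum>x\<in>UNIV. \<Sum>y\<in>UNIV. w y x * a y x)) / 2"
    by (simp only: sum.distrib sum_divide_distrib[symmetric])
  also have "(\<Sum>x\<in>UNIV. \<Sum>y\<in>UNIV. w y x * a y x) = (\<Sum>x\<in>UNIV. \<Sum>y\<in>UNIV. w x y * a x y)"
    by (rule sum.swap)
  also have "((\<Sum>x\<in>UNIV. \<Sum>y\<in>UNIV. w x y * a x y) + (\<Sum>x\<in>UNIV. \<Sum>y\<in>UNIV. w x y * a x y)) / 2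
      = (\<Sum>x\<in>UNIV. m x * (g x)\<^sup>2 / u x * (laplacian P u x + u x))"
    by (simp add: laplacian_eq w_def a_def sum_distrib_left sum_divide_distrib mult_ac)
  also have "\<dots> \<le> (\<Sum>x\<in>UNIV. (1 - l) * (g x * g x * m x))"
  proof (intro sum_mono)
    fix x
    show "m x * (g x)\<^sup>2 / u x * (laplacian P u x + u x) \<le> (1 - l) * (g x * g x * m x)"
    proof (cases "x \<in> X")
      case True
      have "m x * (g x)\<^sup>2 / u x * (laplacian P u x + u x) \<le> m x * (g x)\<^sup>2 / u x * (- l * u x + u x)"
        using sup[OF True] u[OF True] m_nonneg by (intro mult_left_mono) auto
      also have "\<dots> = (1 - l) * (g x * g x * m x)"
        using u[OF True] by (simp add: field_simps power2_eq_square)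
      finally show ?thesis .
    qed (simp add: g)
  qed
  also have "\<dots> = 1 - l" using n by (simp add: sum_distrib_left[symmetric] inner_m_def)
  finally show "l \<le> e" unfolding e energy_eq n w_def by linarith
qed

text \<open>The barrier is \<open>s\<close> itself: \<open>s \<le> D\<close> turns the constant
  decrease \<open>k\<close> into \<open>k / D * s\<close>.\<close>

lemma lambda_set_ge_linear:
  assumes "X \<noteq> {}" "\<And>x. 0 \<le> s x" "\<And>x. x \<in> X \<Longrightarrow> 0 < s x" "\<And>x. s x \<le> D" "0 \<le> k"
    and lap: "\<And>x. x \<in> X \<Longrightarrow> laplacian P s x \<le> - k"
  shows "k / D \<le> lambda_set P m X"
proof (rule lambda_set_ge[where u = s])
  fix x assume x: "x \<in> X"
  then have D: "0 < D" using assms(3)[of x] assms(4)[of x] by linarith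
  have "k / D * s x \<le> k / D * D" using assms D by (intro mult_left_mono) auto
  then show "laplacian P s x \<le> - (k / D) * s x" using lap[OF x] D by simp
qed (use assms in auto)

text \<open>The barrier is \<open>D\<^sup>2 - (D - s)\<^sup>2\<close>, increasing and concave for
  \<open>s\<close> in \<open>[0, D]\<close>. Monotonicity keeps the drift term nonpositive, and
  concavity contributes \<open>- p\<close> from a single steep edge.\<close>

lemma lambda_set_ge_quadratic:
  assumes X: "X \<noteq> {}" and s: "\<And>x. 0 \<le> s x" "\<And>x. x \<in> X \<Longrightarrow> 0 < s x" "\<And>x. s x \<le> D" and p: "0 \<le> p"
    and lap: "\<And>x. x \<in> X \<Longrightarrow> laplacian P s x \<le> 0"
    and nb: "\<And>x. x \<in> X \<Longrightarrow> \<exists>z. p \<le> P x z * (s x - s z)\<^sup>2"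
  shows "p / D\<^sup>2 \<le> lambda_set P m X"
proof (rule lambda_set_ge[where u = "\<lambda>x. s x * (2 * D - s x)"])
  have D0: "0 \<le> D" using s(1,3) order_trans by blast
  show "0 \<le> s x * (2 * D - s x)" for x using s(1)[of x] s(3)[of x] D0 by auto
  show "0 < s x * (2 * D - s x)" if "x \<in> X" for x using s(2)[OF that] s(3)[of x] D0 by auto
  fix x assume x: "x \<in> X"
  then have D: "0 < D" using s(2)[of x] s(3)[of x] by linarith
  obtain z where z: "p \<le> P x z * (s x - s z)\<^sup>2" using nb[OF x] by blast
  also have "\<dots> \<le> (\<Sum>y\<in>UNIV. P x y * (s x - s y)\<^sup>2)"
    by (rule member_le_sum[where f = "\<lambda>y. P x y * (s x - s y)\<^sup>2"]) (auto simp: P_nonneg)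
  finally have grad: "p \<le> (\<Sum>y\<in>UNIV. P x y * (s x - s y)\<^sup>2)" .
  have "laplacian P (\<lambda>x. s x * (2 * D - s x)) x
      = 2 * (D - s x) * laplacian P s x - (\<Sum>y\<in>UNIV. P x y * (s x - s y)\<^sup>2)"
    unfolding laplacian_def sum_distrib_left sum_subtractf[symmetric]
    by (intro sum.cong) (auto simp: algebra_simps power2_eq_square)
  also have "\<dots> \<le> - p"
    using grad mult_nonneg_nonpos[of "2 * (D - s x)" "laplacian P s x"] s(3)[of x] lap[OF x] by auto
  also have "\<dots> = - (p / D\<^sup>2) * D\<^sup>2" using D by simp
  also have "\<dots> \<le> - (p / D\<^sup>2) * (s x * (2 * D - s x))"
  proof -
    have "s x * (2 * D - s x) \<le> D\<^sup>2"
      using zero_le_power2[of "D - s x"] by (simp add: power2_eq_square algebra_simps)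
    from mult_left_mono[OF this, of "p / D\<^sup>2"] show ?thesis using p by auto
  qed
  finally show "laplacian P (\<lambda>x. s x * (2 * D - s x)) x \<le> - (p / D\<^sup>2) * (s x * (2 * D - s x))" .
qed (use X in auto)

text \<open>The drift may have the wrong sign, up to \<open>k\<close>. In the barrier
  \<open>1 - exp (- b * s)\<close> the second-order gain \<open>b\<^sup>2 * p / 2\<close>
  compensates the drift \<open>b * k\<close>, at the price of the weight
  \<open>exp (- b * s) \<ge> exp (- b * D)\<close>.\<close>

lemma lambda_set_ge_exp:
  assumes X: "X \<noteq> {}" and s: "\<And>x. 0 \<le> s x" "\<And>x. x \<in> X \<Longrightarrow> 0 < s x" "\<And>x. s x \<le> D"
    and b: "0 < b" "k \<le> b * p / 2"
    and lap: "\<And>x. x \<in> X \<Longrightarrow> laplacian P s x \<le> k"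
    and nb: "\<And>x. x \<in> X \<Longrightarrow> \<exists>z. s z \<le> s x \<and> p \<le> P x z * (s x - s z)\<^sup>2"
  shows "b * (b * p / 2 - k) * exp (- b * D) \<le> lambda_set P m X"
proof (rule lambda_set_ge[where u = "\<lambda>x. 1 - exp (- b * s x)"])
  show "0 \<le> 1 - exp (- b * s x)" for x using s(1)[of x] b by simp
  show "0 < 1 - exp (- b * s x)" if "x \<in> X" for x using s(2)[OF that] b by simp
  fix x assume x: "x \<in> X"
  \<comment> \<open>Remainder of the exponential after its linear term: nonnegative everywhere, and
    at least quadratic at the neighbour \<open>z\<close>, where the argument is nonnegative.\<close>
  define r where "r = (\<lambda>y. exp (b * (s x - s y)) - 1 - b * (s x - s y))"
  have r0: "0 \<le> r y" for y using exp_ge_add_one_self[of "b * (s x - s y)"] unfolding r_def by linarith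
  obtain z where z: "s z \<le> s x" "p \<le> P x z * (s x - s z)\<^sup>2" using nb[OF x] by blast
  have rz: "(b * (s x - s z))\<^sup>2 / 2 \<le> r z"
    using exp_lower_Taylor_quadratic[of "b * (s x - s z)"] z b by (simp add: r_def)
  have "b\<^sup>2 / 2 * p \<le> b\<^sup>2 / 2 * (P x z * (s x - s z)\<^sup>2)" using z by (intro mult_left_mono) auto
  also have "\<dots> = P x z * ((b * (s x - s z))\<^sup>2 / 2)" by (simp add: power_mult_distrib)
  also have "\<dots> \<le> P x z * r z" using rz P_nonneg by (intro mult_left_mono) auto
  also have "\<dots> \<le> (\<Sum>y\<in>UNIV. P x y * r y)"
    by (rule member_le_sum[where f = "\<lambda>y. P x y * r y"]) (auto simp: P_nonneg r0)
  finally have grad: "b\<^sup>2 / 2 * p \<le> (\<Sum>y\<in>UNIV. P x y * r y)" .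
  have expand: "P x y * (1 - exp (- b * s y) - (1 - exp (- b * s x)))
      = exp (- b * s x) * (b * (P x y * (s y - s x)) - P x y * r y)" for y
  proof -
    define E where "E = exp (- b * s x)"
    have "exp (- b * s y) = E * exp (b * (s x - s y))"
      unfolding E_def exp_add[symmetric] by (simp add: right_diff_distrib)
    then show ?thesis unfolding E_def[symmetric] r_def by (simp add: algebra_simps)
  qed
  have "laplacian P (\<lambda>x. 1 - exp (- b * s x)) x
      = exp (- b * s x) * (b * laplacian P s x - (\<Sum>y\<in>UNIV. P x y * r y))"
    unfolding laplacian_def expand by (simp only: sum_distrib_left[symmetric] sum_subtractf)
  also have "\<dots> \<le> exp (- b * s x) * (b * k - b\<^sup>2 / 2 * p)"
    using grad lap[OF x] b by (intro mult_left_mono diff_mono) auto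
  also have "\<dots> = - (b * (b * p / 2 - k) * exp (- b * s x))" by (simp add: algebra_simps power2_eq_square)
  also have "\<dots> \<le> - (b * (b * p / 2 - k) * exp (- b * D) * 1)"
    using b s(3)[of x] by (simp add: mult_left_mono)
  also have "\<dots> \<le> - (b * (b * p / 2 - k) * exp (- b * D) * (1 - exp (- b * s x)))"
    using b by (intro le_imp_neg_le mult_left_mono) auto
  finally show "laplacian P (\<lambda>x. 1 - exp (- b * s x)) x
      \<le> - (b * (b * p / 2 - k) * exp (- b * D)) * (1 - exp (- b * s x))" by simp
qed (use X in auto)

text \<open>Serves both signs of the drift constant: \<open>Y\<close> is the side favoured by the
  drift, \<open>X\<close> the other one.\<close>

lemma theta_lambda_ge:
  assumes D: "0 < D" and p: "0 < p" and k: "0 \<le> k"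
    and X: "X \<noteq> {}" "\<And>x. 0 \<le> s x" "\<And>x. x \<in> X \<Longrightarrow> 0 < s x" "\<And>x. s x \<le> D"
      "\<And>x. x \<in> X \<Longrightarrow> laplacian P s x \<le> k"
      "\<And>x. x \<in> X \<Longrightarrow> \<exists>z. s z \<le> s x \<and> p \<le> P x z * (s x - s z)\<^sup>2"
    and Y: "Y \<noteq> {}" "\<And>x. 0 \<le> t x" "\<And>x. x \<in> Y \<Longrightarrow> 0 < t x" "\<And>x. t x \<le> D"
      "\<And>x. x \<in> Y \<Longrightarrow> laplacian P t x \<le> - k"
      "\<And>x. x \<in> Y \<Longrightarrow> \<exists>z. t z \<le> t x \<and> p \<le> P x z * (t x - t z)\<^sup>2"
  shows "p / (16 * D\<^sup>2) \<le> theta (lambda_set P m Y) (lambda_set P m X)"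
proof -
  define q where "q = max 1 (k * D / p)"
  have q: "1 \<le> q" "k * D / p \<le> q" by (auto simp: q_def)
  have "p / D\<^sup>2 \<le> lambda_set P m Y"
  proof (intro lambda_set_ge_quadratic[where s = t])
    show "laplacian P t x \<le> 0" if "x \<in> Y" for x using Y(5)[OF that] k by linarith
    show "\<exists>z. p \<le> P x z * (t x - t z)\<^sup>2" if "x \<in> Y" for x using Y(6)[OF that] by blast
  qed (use Y p in auto)
  moreover have "k / D \<le> lambda_set P m Y"
    using Y k by (intro lambda_set_ge_linear[where s = t]) auto
  \<comment> \<open>The quadratic bound covers \<open>q = 1\<close>, the linear one
    \<open>q = k * D / p\<close>.\<close>
  ultimately have lY: "16 * (p / (16 * D\<^sup>2)) * q \<le> lambda_set P m Y"
    using D p unfolding q_def max_def by (auto simp: power2_eq_square)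
  \<comment> \<open>Chosen so that \<open>b * D = 4 * q\<close> and
    \<open>k \<le> b * p / 4\<close>: half of the second-order gain absorbs the drift.\<close>
  define b where "b = 4 * q / D"
  have "k * D \<le> q * p" using q(2) p by (simp add: field_simps)
  then have bk: "k \<le> b * p / 4" using D by (simp add: b_def field_simps)
  have b: "0 < b" using q D by (simp add: b_def)
  have "16 * (p / (16 * D\<^sup>2)) * q * exp (- 4 * q) \<le> b * (b * p / 4) * exp (- b * D)"
  proof -
    have "p / D\<^sup>2 * q * exp (- 4 * q) * 1 \<le> p / D\<^sup>2 * q * exp (- 4 * q) * (4 * q)"
      using q p by (intro mult_left_mono) auto
    then show ?thesis using D by (simp add: b_def power2_eq_square mult_ac)
  qed
  also have "\<dots> \<le> b * (b * p / 2 - k) * exp (- b * D)"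
    using bk b by (intro mult_right_mono mult_left_mono) auto
  also have "\<dots> \<le> lambda_set P m X"
  proof (intro lambda_set_ge_exp[where s = s])
    show "k \<le> b * p / 2" using bk mult_pos_pos[OF b p] by linarith
  qed (use X b in auto)
  finally have "16 * (p / (16 * D\<^sup>2)) * q * exp (- 4 * q) \<le> lambda_set P m X" .
  with lY q D p show ?thesis by (intro theta_ge) auto
qed

section \<open>Curvature and Laplacians of 1-Lipschitz functions\<close>

lemma curvature_le:
  assumes "x \<noteq> y" "lip1 d f" "f y - f x = d x y"
  shows "ollivier_curvature P d x y \<le> (laplacian P f x - laplacian P f y) / d x y"
  unfolding ollivier_curvature_def
proof (rule cInf_lower)
  \<comment> \<open>\<open>M u\<close> bounds the Laplacian at \<open>u\<close> of every 1-Lipschitz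
    function, so the infimum is over a set bounded below.\<close>
  define M where "M = (\<lambda>x. \<Sum>z\<in>UNIV. P x z * d x z)"
  have M: "\<bar>laplacian P g u\<bar> \<le> M u" if "lip1 d g" for g u
    unfolding laplacian_def M_def using that P_nonneg
    by (intro order_trans[OF sum_abs] sum_mono) (auto simp: abs_mult lip1_def intro!: mult_left_mono)
  have "- (M x + M y) / d x y \<le> (laplacian P g x - laplacian P g y) / d x y" if "lip1 d g" for g
    using M[OF that, of x] M[OF that, of y] d_nonneg by (intro divide_right_mono) auto
  then show "bdd_below {(laplacian P f x - laplacian P f y) / d x y |f. lip1 d f \<and> f y - f x = d x y}"
    by (intro bdd_belowI[of _ "- (M x + M y) / d x y"]) auto
qed (use assms in auto)

text \<open>Raising \<open>f\<close> by at most its gap \<open>d x y - (f y - f x)\<close> makes the edge tight, so the curvature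
  bound is stable: the Laplacians are out of order by at most twice the gap.\<close>

lemma laplacian_diff_le:
  assumes "adj P x y" "ollivier_curvature P d x y \<ge> 0" and f: "lip1 d f"
  shows "laplacian P f y - laplacian P f x \<le> 2 * (d x y - (f y - f x))"
proof -
  have xy: "x \<noteq> y" using assms by (simp add: adj_def)
  define e where "e = d x y - (f y - f x)"
  \<comment> \<open>Maximum of \<open>f\<close> with a downward cone whose apex sits at
    \<open>y\<close> and which takes the value \<open>f x\<close> at \<open>x\<close>; hence
    \<open>g\<close> is tight on the edge.\<close>
  define g where "g = (\<lambda>z. max (f z) (f x + d x y - d y z))"
  have e0: "0 \<le> e" using lip1_le[OF f, of y x] by (simp add: e_def)
  have gf: "f z \<le> g z" "g z \<le> f z + e" for z
    using lip1_le[OF f, of y z] e0 d_sym[of y z] by (auto simp: g_def e_def)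
  have "lip1 d g"
    unfolding lip1_iff[OF d_metric]
  proof (intro allI)
    fix u v
    show "g v - g u \<le> d u v"
      using lip1_le[OF f, of v u] d_triangle[of y u v] d_sym[of u v] by (auto simp: g_def)
  qed
  moreover have "g y - g x = d x y"
    using lip1_le[OF f, of y x] by (auto simp: g_def d_sym[of y x] max_def)
  ultimately have "0 \<le> (laplacian P g x - laplacian P g y) / d x y"
    using curvature_le[OF xy] assms(2) order_trans by blast
  then have tight: "laplacian P g y \<le> laplacian P g x"
    using d_pos[OF xy] by (simp add: zero_le_divide_iff)
  have lo: "(\<Sum>z\<in>UNIV. P u z * f z) \<le> (\<Sum>z\<in>UNIV. P u z * g z)" for u
    using gf P_nonneg by (intro sum_mono mult_left_mono) auto
  have hi: "(\<Sum>z\<in>UNIV. P u z * g z) \<le> (\<Sum>z\<in>UNIV. P u z * f z) + e" for u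
  proof -
    have "(\<Sum>z\<in>UNIV. P u z * g z) \<le> (\<Sum>z\<in>UNIV. P u z * (f z + e))"
      using gf P_nonneg by (intro sum_mono mult_left_mono) auto
    then show ?thesis by (simp add: distrib_left sum.distrib sum_distrib_right[symmetric] P_stoch)
  qed
  \<comment> \<open>One \<open>e\<close> comes from averaging \<open>g\<close> around
    \<open>x\<close>, the other from the raised value at \<open>y\<close>.\<close>
  have "laplacian P f y + f y \<le> laplacian P g y + g y"
    "laplacian P g x + g x \<le> laplacian P f x + f x + e"
    using lo[of y] hi[of x] by (simp_all add: laplacian_eq)
  with tight gf(1)[of x] gf(2)[of y] have "laplacian P f y - laplacian P f x \<le> 2 * e" by linarith
  then show ?thesis by (simp only: e_def)
qed

end

section \<open>The separating function\<close>

locale nonneg_curved_chain = reversible_metric_chain +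
  assumes curv: "adj P x y \<Longrightarrow> ollivier_curvature P d x y \<ge> 0"
begin

definition lazy :: "('a \<Rightarrow> real) \<Rightarrow> 'a \<Rightarrow> real" where
  "lazy f x = f x + laplacian P f x / 2"

text \<open>The half step turns the defect of twice the gap into the gap itself, so slopes on edges
  stay at most 1, and the path distance extends this to all pairs.\<close>

lemma lip1_lazy:
  assumes "lip1 d f"
  shows "lip1 d (lazy f)"
proof -
  have "lazy f y - lazy f x \<le> d x y" if "adj P x y" for x y
    using laplacian_diff_le[OF that curv[OF that] assms] by (simp add: lazy_def field_simps)
  then show ?thesis
    unfolding lip1_iff[OF d_metric] using path_distance_lip[OF d_path] by blast
qed

text \<open>The separating function is a fixed point, up to additive constants, of a lazy diffusion step
  followed by making \<open>f\<close> as large as possible on \<open>- X\<close> and then as small as possible on \<open>X\<close>, within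
  the 1-Lipschitz functions.\<close>

lemma laplacian_separation:
  assumes X: "X \<noteq> {}" "X \<noteq> UNIV"
  obtains f c where "lip1 d f"
    and "\<And>x. x \<in> X \<Longrightarrow> \<exists>y. y \<notin> X \<and> f y - f x = d x y"
    and "\<And>y. y \<notin> X \<Longrightarrow> \<exists>x\<in>X. f y - f x = d x y"
    and "\<And>x. x \<in> X \<Longrightarrow> c \<le> laplacian P f x"
    and "\<And>y. y \<notin> X \<Longrightarrow> laplacian P f y \<le> c"
proof -
  \<comment> \<open>\<open>A f\<close> is the largest 1-Lipschitz function below
    \<open>lazy f\<close> on \<open>X\<close>, and \<open>T f\<close> the smallest above
    \<open>A f\<close> off \<open>X\<close>; they agree off \<open>X\<close>.\<close>
  define A where "A = (\<lambda>f z. MIN x\<in>X. lazy f x + d x z)"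
  define T where "T = (\<lambda>f z. MAX y\<in>-X. A f y - d z y)"
  have Xc: "- X \<noteq> {}" using X by auto
  have lipT: "lip1 d (T f)" for f
    unfolding T_def using Xc by (intro lip1_Max d_metric) auto
  have A_le: "A f z \<le> lazy f x + d x z" if "x \<in> X" for f x z
    unfolding A_def using that by (intro Min_le) auto
  have A_attained: "\<exists>x\<in>X. A f z = lazy f x + d x z" for f z
  proof -
    have "A f z \<in> (\<lambda>x. lazy f x + d x z) ` X" unfolding A_def using X by (intro Min_in) auto
    then show ?thesis by auto
  qed
  have T_ge: "A f y - d z y \<le> T f z" if "y \<notin> X" for f y z
    unfolding T_def using that by (intro Max_ge) auto
  have T_attained: "\<exists>y. y \<notin> X \<and> T f z = A f y - d z y" for f z
  proof -
    have "T f z \<in> (\<lambda>y. A f y - d z y) ` (- X)" unfolding T_def using Xc by (intro Max_in) auto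
    then show ?thesis by auto
  qed
  have A_lip: "A f y - A f z \<le> d z y" for f y z
    using lip1_le[OF lip1_Min[OF d_metric _ X(1), of "lazy f"]] by (simp add: A_def)
  have T_le_A: "T f z \<le> A f z" for f z
    using T_attained[of f z] A_lip[of f _ z] by (smt (verit))
  have T_eq_A: "T f y = A f y" if "y \<notin> X" for f y
    using T_ge[OF that, of f y] T_le_A[of f y] by simp
  \<comment> \<open>Lowering \<open>lazy f\<close> on \<open>X\<close> and raising it elsewhere will
    give the two Laplacian bounds at the fixed point.\<close>
  have T_le: "T f x \<le> lazy f x" if "x \<in> X" for f x
    using T_le_A[of f x] A_le[OF that, of f x] by simp
  have le_T: "lazy f y \<le> T f y" if f: "lip1 d f" and y: "y \<notin> X" for f y
    using A_attained[of f y] lip1_le[OF lip1_lazy[OF f]] T_eq_A[OF y, of f] by (smt (verit))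

  \<comment> \<open>Fixing the value at an arbitrary point removes the additive constants, so the
    1-Lipschitz functions form a compact convex set and Brouwer applies.\<close>
  obtain x0 :: 'a where True by blast
  define S where "S = {v::real^'a. lip1 d (($) v) \<and> v $ x0 = 0}"
  define F where "F = (\<lambda>v::real^'a. \<chi> z. T (($) v) z - T (($) v) x0)"
  have S_eq: "S = (\<Inter>x. \<Inter>y. {v. v $ y - v $ x \<le> d x y}) \<inter> {v. v $ x0 = 0}"
    unfolding S_def lip1_iff[OF d_metric] by auto
  have "closed S" unfolding S_eq
    by (intro closed_Int closed_INT ballI closed_Collect_le closed_Collect_eq continuous_intros)
  moreover have "bounded S"
  proof (rule bounded_subset[OF bounded_cbox])
    show "S \<subseteq> cbox (\<chi> z. - d x0 z) (\<chi> z. d x0 z)"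
    proof
      fix v assume "v \<in> S"
      then show "v \<in> cbox (\<chi> z. - d x0 z) (\<chi> z. d x0 z)"
        unfolding S_def mem_box_cart lip1_def by (simp add: abs_le_iff) (smt (verit))
    qed
  qed
  ultimately have "compact S" by (simp add: compact_eq_bounded_closed)
  moreover have "convex S"
  proof (rule convexI)
    fix v w :: "real^'a" and a b :: real
    assume vw: "v \<in> S" "w \<in> S" and ab: "0 \<le> a" "0 \<le> b" "a + b = 1"
    have "a * v $ y + b * w $ y - (a * v $ x + b * w $ x) \<le> d x y" for x y
    proof -
      have "a * (v $ y - v $ x) + b * (w $ y - w $ x) \<le> a * d x y + b * d x y"
        using vw ab by (intro add_mono mult_left_mono) (auto simp: S_eq)
      also have "\<dots> = d x y" using ab by (simp flip: distrib_right)
      finally show ?thesis by (simp add: algebra_simps)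
    qed
    then show "a *\<^sub>R v + b *\<^sub>R w \<in> S" using vw by (auto simp: S_eq)
  qed
  moreover have "0 \<in> S" by (auto simp: S_eq d_nonneg)
  then have "S \<noteq> {}" by auto
  moreover have "continuous_on S F"
    unfolding F_def T_def A_def lazy_def laplacian_def
    by (intro continuous_on_vec_lambda continuous_on_diff continuous_on_MAX continuous_on_MIN
        continuous_intros) (use X Xc in auto)
  moreover have "F ` S \<subseteq> S"
    using lip1_le[OF lipT] by (auto simp: S_eq F_def)
  ultimately obtain v where v: "v \<in> S" "F v = v"
    using brouwer[of S F] by (auto simp: image_subset_iff Pi_iff)
  define f where "f = ($) v"
  define c where "c = T f x0"
  have lipf: "lip1 d f" using v by (simp add: S_def f_def)
  have Tf: "T f z = f z + c" for z
    using arg_cong[OF v(2), of "\<lambda>w. w $ z"] by (simp add: F_def f_def c_def)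
  show thesis
  \<comment> \<open>\<open>T\<close> shifts \<open>f\<close> by \<open>c\<close>; the factor 2
    undoes the half in \<open>lazy\<close>.\<close>
  proof (rule that[of f "2 * c"])
    show "\<exists>y. y \<notin> X \<and> f y - f x = d x y" if "x \<in> X" for x
    proof -
      obtain y where y: "y \<notin> X" "T f x = A f y - d x y" using T_attained by blast
      then show ?thesis using T_eq_A[OF y(1), of f] Tf[of x] Tf[of y] by (intro exI[of _ y]) auto
    qed
    show "\<exists>x\<in>X. f y - f x = d x y" if y: "y \<notin> X" for y
    proof -
      obtain x where x: "x \<in> X" "A f y = lazy f x + d x y" using A_attained by blast
      show ?thesis
        \<comment> \<open>\<open>T f x \<le> lazy f x\<close> makes the increase from
          \<open>x\<close> to \<open>y\<close> at least \<open>d x y\<close>; the Lipschitz bound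
          gives the converse.\<close>
        using T_eq_A[OF y, of f] T_le[OF x(1), of f] lip1_le[OF lipf, of y x] Tf[of x] Tf[of y] x
        by (intro bexI[of _ x]) auto
    qed
    show "2 * c \<le> laplacian P f x" if "x \<in> X" for x
      using T_le[OF that, of f] Tf[of x] by (simp add: lazy_def)
    show "laplacian P f y \<le> 2 * c" if "y \<notin> X" for y
      using le_T[OF lipf that] Tf[of y] by (simp add: lazy_def)
  qed (rule lipf)
qed

section \<open>Comparison of a set with its complement\<close>

lemma theta_lambda_set_ge:
  assumes X: "X \<noteq> {}" "X \<noteq> UNIV"
  shows "P0 P d / (16 * (diam d)\<^sup>2) \<le> theta (lambda_set P m X) (lambda_set P m (UNIV - X))"
proof -
  obtain f c where f: "lip1 d f"
    and up: "\<And>x. x \<in> X \<Longrightarrow> \<exists>y. y \<notin> X \<and> f y - f x = d x y"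
    and down: "\<And>y. y \<notin> X \<Longrightarrow> \<exists>x\<in>X. f y - f x = d x y"
    and lapX: "\<And>x. x \<in> X \<Longrightarrow> c \<le> laplacian P f x"
    and lapY: "\<And>y. y \<notin> X \<Longrightarrow> laplacian P f y \<le> c"
    using laplacian_separation[OF X] by metis
  \<comment> \<open>The depth below the maximum serves on \<open>X\<close>, the height above the
    minimum on the complement; both lie between 0 and the diameter.\<close>
  define s where "s = (\<lambda>x. Max (range f) - f x)"
  define t where "t = (\<lambda>x. f x + (- Min (range f)))"
  have "Max (range f) \<in> range f" "Min (range f) \<in> range f" by (intro Max_in Min_in; simp)+
  then obtain zM zm where zM: "Max (range f) = f zM" and zm: "Min (range f) = f zm" by blast
  have f_le: "f x \<le> f zM" and f_ge: "f zm \<le> f x" for x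
    using Max_ge[of "range f" "f x"] Min_le[of "range f" "f x"] by (auto simp: zM zm)
  have upd: "\<exists>z. f x < f z \<and> P0 P d \<le> P x z * (f z - f x)\<^sup>2" if x: "x \<in> X" for x
  proof -
    obtain y where y: "y \<notin> X" "f y - f x = d x y" using up[OF x] by blast
    then have "x \<noteq> y" using x by auto
    then obtain z where z: "adj P x z" "d x y = d x z + d z y"
      using path_distance_first_step[OF d_metric d_path] by metis
    \<comment> \<open>Full slope from \<open>x\<close> to \<open>y\<close> forces full slope on both
      pieces of the split distance.\<close>
    then have "f z - f x = d x z" using y lip1_le[OF f, of z x] lip1_le[OF f, of y z] by simp
    moreover have "0 < d x z" using z by (simp add: d_pos adj_def)
    ultimately show ?thesis using P0_le[OF z(1)] by (intro exI[of _ z]) auto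
  qed
  have downd: "\<exists>z. f z < f y \<and> P0 P d \<le> P y z * (f y - f z)\<^sup>2" if y: "y \<notin> X" for y
  proof -
    obtain x where x: "x \<in> X" "f y - f x = d x y" using down[OF y] by blast
    then have "y \<noteq> x" using y by auto
    then obtain z where z: "adj P y z" "d y x = d y z + d z x"
      using path_distance_first_step[OF d_metric d_path] by metis
    then have "f y - f z = d y z"
      using x lip1_le[OF f, of y z] lip1_le[OF f, of z x] d_sym[of x y] d_sym[of x z] d_sym[of y z] by simp
    moreover have "0 < d y z" using z by (simp add: d_pos adj_def)
    ultimately show ?thesis using P0_le[OF z(1)] by (intro exI[of _ z]) auto
  qed
  have s: "0 \<le> s x" "s x \<le> diam d" for x
    using f_le[of x] lip1_le[OF f, of zM x] diam_ge[of x zM] by (auto simp: s_def zM)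
  have t: "0 \<le> t x" "t x \<le> diam d" for x
    using f_ge[of x] lip1_le[OF f, of x zm] diam_ge[of zm x] by (auto simp: t_def zm)
  have sX: "0 < s x" "\<exists>z. s z \<le> s x \<and> P0 P d \<le> P x z * (s x - s z)\<^sup>2" if x: "x \<in> X" for x
  proof -
    obtain z where z: "f x < f z" "P0 P d \<le> P x z * (f z - f x)\<^sup>2" using upd[OF x] by blast
    show "0 < s x" using z f_le[of z] by (simp add: s_def zM)
    show "\<exists>z. s z \<le> s x \<and> P0 P d \<le> P x z * (s x - s z)\<^sup>2"
      using z by (intro exI[of _ z]) (simp add: s_def)
  qed
  have tY: "0 < t x" "\<exists>z. t z \<le> t x \<and> P0 P d \<le> P x z * (t x - t z)\<^sup>2" if x: "x \<in> UNIV - X" for x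
  proof -
    obtain z where z: "f z < f x" "P0 P d \<le> P x z * (f x - f z)\<^sup>2" using downd x by blast
    show "0 < t x" using z f_ge[of z] by (simp add: t_def zm)
    show "\<exists>z. t z \<le> t x \<and> P0 P d \<le> P x z * (t x - t z)\<^sup>2"
      using z by (intro exI[of _ z]) (simp add: t_def)
  qed
  have ls: "laplacian P s x \<le> - c" if "x \<in> X" for x
    using lapX[OF that] by (simp add: s_def laplacian_minus)
  have lt: "laplacian P t x \<le> c" if "x \<in> UNIV - X" for x
    using lapY[of x] that unfolding t_def laplacian_add_const by simp
  have ne: "UNIV - X \<noteq> {}" using X by auto
  show ?thesis
  \<comment> \<open>The sign of \<open>c\<close> decides which side gets the exponential barrier:
    \<open>X\<close> if \<open>c \<le> 0\<close>, otherwise the complement.\<close>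
  proof (cases "c \<le> 0")
    case True
    have "P0 P d / (16 * (diam d)\<^sup>2) \<le> theta (lambda_set P m (UNIV - X)) (lambda_set P m X)"
      by (rule theta_lambda_ge[where k = "- c" and s = s and t = t])
        (use True diam_pos P0_pos X ne s t sX tY ls lt in simp_all)
    then show ?thesis by (simp add: theta_commute)
  next
    case False
    show ?thesis
      by (rule theta_lambda_ge[where k = c and s = t and t = s])
        (use False diam_pos P0_pos X ne s t sX tY ls lt in simp_all)
  qed
qed

end

theorem theorem5p4:
  fixes P d :: "'a::finite \<Rightarrow> 'a \<Rightarrow> real" and m :: "'a \<Rightarrow> real"
  assumes nontriv: "\<exists>x y :: 'a. x \<noteq> y"
    and P_nonneg: "\<forall>x y. P x y \<ge> 0"
    and P_stoch: "\<forall>x. (\<Sum>y\<in>UNIV. P x y) = 1"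
    and P_sym_supp: "\<forall>x y. P x y > 0 \<longleftrightarrow> P y x > 0"
    and d_metric: "metric_fun d"
    and d_path: "path_distance P d"
    and m_nonneg: "\<forall>x. m x \<ge> 0"
    and m_prob: "(\<Sum>x\<in>UNIV. m x) = 1"
    and reversible: "\<forall>x y. m x * P x y = m y * P y x"
    and curv: "\<forall>x y. adj P x y \<longrightarrow> ollivier_curvature P d x y \<ge> 0"
  shows "alpha_spectral P m \<ge> P0 P d / (16 * (diam d)\<^sup>2)"
proof -
  interpret nonneg_curved_chain P d m
    by unfold_locales (use assms in blast)+
  \<comment> \<open>A singleton is a proper subset, so the infimum is over a nonempty
    family.\<close>
  obtain x y :: 'a where "x \<noteq> y" using nontriv by blast
  then have "{x} \<noteq> {}" "{x} \<noteq> UNIV" by auto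
  then have "{theta (lambda_set P m X) (lambda_set P m (UNIV - X)) |X. X \<noteq> {} \<and> X \<noteq> UNIV} \<noteq> {}"
    by blast
  then show ?thesis
    unfolding alpha_spectral_def using theta_lambda_set_ge by (intro cInf_greatest) auto
qed

end
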